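(* Let $\mathfrak q$ be a finite-dimensional Lie algebra over a field $\Bbbk$. For any $D\in\mathfrak{gl}(\mathfrak q)$ one has $$[x,y]''_D=2\,\mathcal T_D(x,y)-[x,y]'_{D^2}\qquad\text{for all }x,y\in\mathfrak q .$$
   Context: For $A\in\mathfrak{gl}(\mathfrak q)$, the derived operation of the Lie bracket is $[x,y]'_A=A([x,y])-[Ax,y]-[x,Ay]$, and the second derived operation is $[x,y]''_A=A([x,y]'_A)-[Ax,y]'_A-[x,Ay]'_A$. The Nijenhuis torsion of $D\in\mathfrak{gl}(\mathfrak q)$ is $$\mathcal T_D(x,y)=[Dx,Dy]+D\bigl(D([x,y])-[Dx,y]-[x,Dy]\bigr).$$ *)

theory Defs
  imports Complex_Main
begin

locale lie_algebra = vector_space scale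
  for scale :: "'k::field \<Rightarrow> 'q::ab_group_add \<Rightarrow> 'q" +
  fixes bracket :: "'q \<Rightarrow> 'q \<Rightarrow> 'q"
  assumes linear_bracket_left: "Vector_Spaces.linear scale scale (\<lambda>x. bracket x y)"
    and linear_bracket_right: "Vector_Spaces.linear scale scale (\<lambda>y. bracket x y)"
    and bracket_self: "bracket x x = 0"
    and jacobi: "bracket x (bracket y z) + bracket y (bracket z x) + bracket z (bracket x y) = 0"

text \<open>\<open>Basis\<close> only witnesses finite dimensionality: it is an arbitrary finite basis, and no
  axiom relates it to the bracket.\<close>

locale finite_dimensional_lie_algebra =
  finite_dimensional_vector_space scale Basis + lie_algebra scale bracket
  for scale :: "'k::field \<Rightarrow> 'q::ab_group_add \<Rightarrow> 'q"
    and Basis :: "'q set"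
    and bracket :: "'q \<Rightarrow> 'q \<Rightarrow> 'q"

definition gl :: "('k::field \<Rightarrow> 'q::ab_group_add \<Rightarrow> 'q) \<Rightarrow> ('q \<Rightarrow> 'q) set" where
  "gl scale = {A. Vector_Spaces.linear scale scale A}"

definition derived_op ::
  "('q::ab_group_add \<Rightarrow> 'q \<Rightarrow> 'q) \<Rightarrow> ('q \<Rightarrow> 'q) \<Rightarrow> 'q \<Rightarrow> 'q \<Rightarrow> 'q" where
  "derived_op f A x y = A (f x y) - f (A x) y - f x (A y)"

definition second_derived_op ::
  "('q::ab_group_add \<Rightarrow> 'q \<Rightarrow> 'q) \<Rightarrow> ('q \<Rightarrow> 'q) \<Rightarrow> 'q \<Rightarrow> 'q \<Rightarrow> 'q" where
  "second_derived_op f A x y =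
     A (derived_op f A x y) - derived_op f A (A x) y - derived_op f A x (A y)"

definition nijenhuis_torsion ::
  "('q::ab_group_add \<Rightarrow> 'q \<Rightarrow> 'q) \<Rightarrow> ('q \<Rightarrow> 'q) \<Rightarrow> 'q \<Rightarrow> 'q \<Rightarrow> 'q" where
  "nijenhuis_torsion f D x y = f (D x) (D y) + D (D (f x y) - f (D x) y - f x (D y))"

end

theory Submission
  imports Defs
begin

text \<open>Applying \<open>D\<close> to the derived operation of \<open>f\<close> produces
  \<open>D (D (f x y)) - D (f (D x) y) - D (f x (D y))\<close>, and the two remaining derived operations
  contribute a second copy of each mixed term \<open>D (f (D x) y)\<close>, \<open>D (f x (D y))\<close>, two copies of
  \<open>f (D x) (D y)\<close>, and the terms \<open>f (D (D x)) y\<close>, \<open>f x (D (D y))\<close>. Twice the torsion accounts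
  for the doubled terms; it contains one \<open>D (D (f x y))\<close> too many and lacks the last two terms,
  which is exactly what subtracting the derived operation of \<open>D \<circ> D\<close> corrects.\<close>

lemma second_derived_op_eq_torsion:
  assumes "additive D"
  shows "second_derived_op f D x y =
    (nijenhuis_torsion f D x y + nijenhuis_torsion f D x y) - derived_op f (D \<circ> D) x y"
  by (simp add: second_derived_op_def derived_op_def nijenhuis_torsion_def
      additive.diff[OF assms] additive.add[OF assms] algebra_simps)

theorem proposition8p3:
  fixes scale :: "'k::field \<Rightarrow> 'q::ab_group_add \<Rightarrow> 'q"
    and Basis :: "'q set"
    and bracket :: "'q \<Rightarrow> 'q \<Rightarrow> 'q"
    and D :: "'q \<Rightarrow> 'q"
  assumes "finite_dimensional_lie_algebra scale Basis bracket"
    and "D \<in> gl scale"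
  shows "\<forall>x y. second_derived_op bracket D x y =
           scale 2 (nijenhuis_torsion bracket D x y) - derived_op bracket (D \<circ> D) x y"
proof (intro allI)
  fix x y
  interpret finite_dimensional_lie_algebra scale Basis bracket
    by (fact assms(1))
  have "Vector_Spaces.linear scale scale D"
    using assms(2) by (simp add: gl_def)
  then have "additive D"
    by (simp add: additive_def Vector_Spaces.linear_iff)
  moreover have "scale 2 v = v + v" for v
    using scale_left_distrib[of 1 1 v] by simp
  ultimately show "second_derived_op bracket D x y =
      scale 2 (nijenhuis_torsion bracket D x y) - derived_op bracket (D \<circ> D) x y"
    by (simp add: second_derived_op_eq_torsion)
qed

end
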